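(* Let $T$ be an integral domain. Any prime ideal of $R(T)$ is generated by elements of the form $1/f$ with $f\in T\setminus\{0\}$.
   Context: For an integral domain $T$ with fraction field $F(T)$, the reciprocal complement $R(T)$ is the subring of $F(T)$ generated by all $1/f$ with $f\in T\setminus\{0\}$; equivalently, $R(T)$ is the set of all finite sums $\frac1{f_1}+\cdots+\frac1{f_t}$ with $t\ge 0$ and each $f_i\in T\setminus\{0\}$. (The zero ideal is regarded as generated by the empty set.) *)

theory Defs
  imports
    "HOL-Algebra.Algebraic_Closure_Type"
    "HOL-Algebra.Generated_Rings"
begin

text \<open>
  The domain \<open>T\<close> is a type of class \<open>idom\<close> and its fraction field is the type \<open>'a fract\<close>.
  Ideals and prime ideals are those of HOL-Algebra; to make them available for a subring of
  \<open>'a fract\<close>, the type is turned into a ring record by \<open>ring_of_type_algebra\<close>.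
\<close>

definition reciprocals :: "'a::idom fract set" where
  "reciprocals = {1 / to_fract f | f. f \<noteq> 0}"

definition reciprocal_complement :: "'a::idom fract ring" where
  "reciprocal_complement =
     ring_of_type_algebra \<lparr>carrier := generate_ring ring_of_type_algebra reciprocals\<rparr>"

lemma ring_of_type_algebra_sel [simp]:
  "carrier (ring_of_type_algebra :: 'b::ring_1 ring) = UNIV"
  "x \<otimes>\<^bsub>ring_of_type_algebra\<^esub> y = x * (y :: 'b)"
  "x \<oplus>\<^bsub>ring_of_type_algebra\<^esub> y = x + (y :: 'b)"
  "\<one>\<^bsub>ring_of_type_algebra\<^esub> = (1 :: 'b)"
  "\<zero>\<^bsub>ring_of_type_algebra\<^esub> = (0 :: 'b)"
  by (simp_all add: ring_of_type_algebra_def)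

lemma a_inv_ring_of_type_algebra [simp]:
  "\<ominus>\<^bsub>ring_of_type_algebra\<^esub> x = - (x :: 'b::comm_ring_1)"
proof -
  interpret ring "ring_of_type_algebra :: 'b ring"
    by (rule ring_from_type_algebra)
  show ?thesis
    using minus_equality[of "- x" x] by simp
qed

lemma cring_reciprocal_complement: "cring (reciprocal_complement :: 'a::idom fract ring)"
proof -
  interpret K: cring "ring_of_type_algebra :: 'a fract ring"
    by (rule cring_from_type_algebra)
  have "subring (generate_ring ring_of_type_algebra reciprocals) (ring_of_type_algebra :: 'a fract ring)"
    by (rule K.generate_ring_is_subring) simp
  then have "subcring (generate_ring ring_of_type_algebra reciprocals) (ring_of_type_algebra :: 'a fract ring)"
    by (rule K.subcringI')
  then show ?thesis
    unfolding reciprocal_complement_def by (subst (asm) K.subcring_iff) simp_all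
qed

lemma carrier_reciprocal_complement:
  "carrier (reciprocal_complement :: 'a::idom fract ring) =
     {\<Sum>f\<leftarrow>fs. 1 / to_fract f | fs. 0 \<notin> set fs}"
    (is "_ = ?S")
proof -
  let ?r = "\<lambda>f. 1 / to_fract f :: 'a fract"
  have sum: "(\<Sum>f\<leftarrow>fs. ?r f) \<in> ?S" if "0 \<notin> set fs" for fs
    using that by blast
  have add: "x + y \<in> ?S" if "x \<in> ?S" "y \<in> ?S" for x y
  proof -
    from that obtain fs gs where "x = (\<Sum>f\<leftarrow>fs. ?r f)" "y = (\<Sum>f\<leftarrow>gs. ?r f)"
      "0 \<notin> set fs" "0 \<notin> set gs" by blast
    then show ?thesis using sum[of "fs @ gs"] by simp
  qed
  have minus: "- x \<in> ?S" if "x \<in> ?S" for x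
  proof -
    from that obtain fs where fs: "x = (\<Sum>f\<leftarrow>fs. ?r f)" "0 \<notin> set fs" by blast
    have "- (\<Sum>f\<leftarrow>fs. ?r f) = (\<Sum>f\<leftarrow>map uminus fs. ?r f)"
      by (induction fs) (simp_all add: to_fract_uminus)
    moreover have "0 \<notin> set (map uminus fs)" using fs(2) by auto
    ultimately show ?thesis using sum fs(1) by (simp only:)
  qed
  have mult1: "?r a * (\<Sum>f\<leftarrow>fs. ?r f) \<in> ?S" if "0 \<notin> set fs" "a \<noteq> 0" for a fs
  proof -
    have "?r a * (\<Sum>f\<leftarrow>fs. ?r f) = (\<Sum>f\<leftarrow>map ((*) a) fs. ?r f)"
      by (induction fs) (simp_all add: algebra_simps)
    moreover have "0 \<notin> set (map ((*) a) fs)" using that by auto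
    ultimately show ?thesis using sum by (simp only:)
  qed
  have mult: "x * y \<in> ?S" if "x \<in> ?S" "y \<in> ?S" for x y
  proof -
    from that obtain fs gs where *: "x = (\<Sum>f\<leftarrow>fs. ?r f)" "y = (\<Sum>f\<leftarrow>gs. ?r f)"
      "0 \<notin> set fs" "0 \<notin> set gs" by blast
    have "(\<Sum>f\<leftarrow>fs. ?r f) * (\<Sum>f\<leftarrow>gs. ?r f) \<in> ?S" using *(3)
    proof (induction fs)
      case Nil
      show ?case using sum[of "[]"] by simp
    next
      case (Cons a fs)
      then show ?case
        using add[OF mult1[OF *(4), of a]] by (simp add: distrib_right)
    qed
    then show ?thesis using * by simp
  qed
  have "x \<in> ?S" if "x \<in> generate_ring ring_of_type_algebra reciprocals" for x
    using that
  proof (induction rule: generate_ring.induct)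
    case one
    show ?case using sum[of "[1]"] by simp
  next
    case (incl h)
    then obtain f where "h = ?r f" "f \<noteq> 0" by (auto simp: reciprocals_def)
    then show ?case using sum[of "[f]"] by simp
  next
    case (a_inv h)
    then show ?case using minus by simp
  next
    case (eng_add h1 h2)
    then show ?case using add by simp
  next
    case (eng_mult h1 h2)
    then show ?case using mult by simp
  qed
  moreover have "(\<Sum>f\<leftarrow>fs. ?r f) \<in> generate_ring ring_of_type_algebra reciprocals"
    if "0 \<notin> set fs" for fs
    using that
  proof (induction fs)
    case Nil
    show ?case
      using ring.zero_in_generate[OF ring_from_type_algebra, of "reciprocals :: 'a fract set"]
      by simp
  next
    case (Cons a fs)
    have "?r a \<in> reciprocals" using Cons.prems by (auto simp: reciprocals_def)
    then show ?case
      using generate_ring.eng_add[OF generate_ring.incl, of "?r a" reciprocals _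
          ring_of_type_algebra] Cons by simp
  qed
  ultimately show ?thesis
    by (auto simp: reciprocal_complement_def)
qed

end

theory Submission
  imports Defs
begin

text \<open>
  Let \<open>x = 1/f\<^sub>1 + \<dots> + 1/f\<^sub>t\<close> be a nonzero element of a prime ideal \<open>P\<close> of \<open>R(T)\<close>. Over the
  common denominator, \<open>x = N / (f\<^sub>1 \<cdots> f\<^sub>t)\<close> with a nonzero numerator \<open>N \<in> T\<close>, so \<open>1/N\<close> lies in
  \<open>R(T)\<close> and \<open>(1/N) x = 1/(f\<^sub>1 \<cdots> f\<^sub>t)\<close> lies in \<open>P\<close>. As \<open>P\<close> is prime, some \<open>1/f\<^sub>i\<close> lies in \<open>P\<close>
  (lemma \<open>primeideal_contains_summand\<close>). Then \<open>x - 1/f\<^sub>i\<close> is an element of \<open>P\<close> with one summand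
  fewer. By induction on \<open>t\<close>, every element of \<open>P\<close> is a combination of reciprocals that lie in \<open>P\<close>,
  so the set of all reciprocals in \<open>P\<close> generates \<open>P\<close>.
\<close>

lemma reciprocal_complement_sel [simp]:
  "x \<otimes>\<^bsub>reciprocal_complement\<^esub> y = x * (y :: 'a::idom fract)"
  "x \<oplus>\<^bsub>reciprocal_complement\<^esub> y = x + (y :: 'a fract)"
  "\<one>\<^bsub>reciprocal_complement\<^esub> = (1 :: 'a fract)"
  "\<zero>\<^bsub>reciprocal_complement\<^esub> = (0 :: 'a fract)"
  by (simp_all add: reciprocal_complement_def)

lemma reciprocals_subset_carrier:
  "reciprocals \<subseteq> carrier (reciprocal_complement :: 'a::idom fract ring)"
  by (auto simp: reciprocal_complement_def intro: generate_ring.incl)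

lemma reciprocal_in_carrier:
  "f \<noteq> 0 \<Longrightarrow> 1 / to_fract f \<in> carrier (reciprocal_complement :: 'a::idom fract ring)"
  using reciprocals_subset_carrier by (auto simp: reciprocals_def)

lemma a_inv_reciprocal_complement:
  fixes x :: "'a::idom fract"
  assumes "x \<in> carrier reciprocal_complement"
  shows "\<ominus>\<^bsub>reciprocal_complement\<^esub> x = - x"
proof -
  interpret R: cring "reciprocal_complement :: 'a fract ring"
    by (rule cring_reciprocal_complement)
  show ?thesis
    using R.l_neg[OF assms] by (simp add: add_eq_0_iff2)
qed

lemma diff_in_ideal:
  fixes x y :: "'a::idom fract"
  assumes "ideal I (reciprocal_complement :: 'a fract ring)" "x \<in> I" "y \<in> I"
  shows "x - y \<in> I"
proof -
  interpret ideal I "reciprocal_complement :: 'a fract ring" by fact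
  have "x \<oplus>\<^bsub>reciprocal_complement\<^esub> (\<ominus>\<^bsub>reciprocal_complement\<^esub> y) \<in> I"
    using additive_subgroup.a_closed[OF additive_subgroup_axioms]
      additive_subgroup.a_inv_closed[OF additive_subgroup_axioms] assms(2,3) by blast
  then show ?thesis
    using a_inv_reciprocal_complement[OF a_Hcarr[OF assms(3)]] by simp
qed

lemma sum_reciprocals_common_denominator:
  fixes fs :: "'a::idom list"
  assumes "0 \<notin> set fs"
  shows "\<exists>N. (\<Sum>f\<leftarrow>fs. 1 / to_fract f) = to_fract N / to_fract (prod_list fs)"
  using assms
proof (induction fs)
  case Nil
  show ?case by (auto intro: exI[of _ 0])
next
  case (Cons a fs)
  then obtain N where N: "(\<Sum>f\<leftarrow>fs. 1 / to_fract f) = to_fract N / to_fract (prod_list fs)"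
    by auto
  have "a \<noteq> 0" "prod_list fs \<noteq> 0"
    using Cons.prems by (auto simp: prod_list_zero_iff)
  then have "(\<Sum>f\<leftarrow>a # fs. 1 / to_fract f)
      = to_fract (prod_list fs + a * N) / to_fract (prod_list (a # fs))"
    by (simp add: N field_simps)
  then show ?case by blast
qed

lemma primeideal_prod_reciprocal:
  fixes fs :: "'a::idom list"
  assumes "primeideal P (reciprocal_complement :: 'a fract ring)"
    and "0 \<notin> set fs" "1 / to_fract (prod_list fs) \<in> P"
  shows "\<exists>f\<in>set fs. 1 / to_fract f \<in> P"
proof -
  interpret primeideal P "reciprocal_complement :: 'a fract ring" by fact
  show ?thesis using assms(2,3)
  proof (induction fs)
    case Nil
    then have "P = carrier reciprocal_complement"
      using one_imp_carrier by simp
    then show ?case using I_notcarr by simp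
  next
    case (Cons a fs)
    have "1 / to_fract a \<in> carrier reciprocal_complement"
      "1 / to_fract (prod_list fs) \<in> carrier reciprocal_complement"
      using Cons.prems(1) by (auto intro!: reciprocal_in_carrier simp: prod_list_zero_iff)
    moreover have "1 / to_fract a \<otimes>\<^bsub>reciprocal_complement\<^esub> (1 / to_fract (prod_list fs)) \<in> P"
      using Cons.prems(2) by simp
    ultimately have "1 / to_fract a \<in> P \<or> 1 / to_fract (prod_list fs) \<in> P"
      by (rule I_prime)
    then show ?case
      using Cons by auto
  qed
qed

text \<open>
  Multiplying by the reciprocal of the numerator, which is an element of \<open>R(T)\<close>, leaves the
  reciprocal of the common denominator in \<open>P\<close>. The sum has to be nonzero for the numerator to be
  invertible: \<open>1/f + 1/(-f) = 0\<close> lies in every ideal.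
\<close>

lemma primeideal_contains_summand:
  fixes fs :: "'a::idom list"
  assumes P: "primeideal P (reciprocal_complement :: 'a fract ring)"
    and fs: "0 \<notin> set fs" and mem: "(\<Sum>f\<leftarrow>fs. 1 / to_fract f) \<in> P"
    and nz: "(\<Sum>f\<leftarrow>fs. 1 / to_fract f) \<noteq> 0"
  shows "\<exists>f\<in>set fs. 1 / to_fract f \<in> P"
proof -
  interpret primeideal P "reciprocal_complement :: 'a fract ring" by fact
  obtain N where N: "(\<Sum>f\<leftarrow>fs. 1 / to_fract f) = to_fract N / to_fract (prod_list fs)"
    using sum_reciprocals_common_denominator[OF fs] by blast
  have "N \<noteq> 0" using nz N by auto
  then have "1 / to_fract N \<otimes>\<^bsub>reciprocal_complement\<^esub> (\<Sum>f\<leftarrow>fs. 1 / to_fract f) \<in> P"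
    using I_l_closed[OF mem] reciprocal_in_carrier by blast
  then have "1 / to_fract (prod_list fs) \<in> P"
    using \<open>N \<noteq> 0\<close> by (simp add: N)
  then show ?thesis
    using primeideal_prod_reciprocal[OF P fs] by blast
qed

lemma sum_reciprocals_in_genideal:
  fixes fs :: "'a::idom list"
  assumes P: "primeideal P (reciprocal_complement :: 'a fract ring)"
    and "0 \<notin> set fs" "(\<Sum>f\<leftarrow>fs. 1 / to_fract f) \<in> P"
  shows "(\<Sum>f\<leftarrow>fs. 1 / to_fract f) \<in> Idl\<^bsub>reciprocal_complement\<^esub> (P \<inter> reciprocals)"
    (is "_ \<in> ?I")
  using assms(2,3)
proof (induction "length fs" arbitrary: fs rule: less_induct)
  case less
  interpret primeideal P "reciprocal_complement :: 'a fract ring" by fact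
  have sub: "P \<inter> reciprocals \<subseteq> carrier reciprocal_complement"
    using reciprocals_subset_carrier by blast
  interpret I: ideal ?I "reciprocal_complement :: 'a fract ring"
    using genideal_ideal[OF sub] .
  show ?case
  proof (cases "(\<Sum>f\<leftarrow>fs. 1 / to_fract f) = 0")
    case True
    then show ?thesis using I.zero_closed by simp
  next
    case False
    then obtain f where f: "f \<in> set fs" "1 / to_fract f \<in> P"
      using primeideal_contains_summand[OF P less.prems] by blast
    have split: "(\<Sum>g\<leftarrow>fs. 1 / to_fract g)
        = 1 / to_fract f + (\<Sum>g\<leftarrow>remove1 f fs. 1 / to_fract g)"
      using f(1) by (rule sum_list_map_remove1)
    have "(\<Sum>g\<leftarrow>remove1 f fs. 1 / to_fract g) \<in> P"
      using diff_in_ideal[OF is_ideal less.prems(2) f(2)] by (simp add: split)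
    moreover have "length (remove1 f fs) < length fs"
      using f(1) length_pos_if_in_set[OF f(1)] by (simp add: length_remove1)
    moreover have "0 \<notin> set (remove1 f fs)"
      using less.prems(1) set_remove1_subset[of f fs] by blast
    ultimately have "(\<Sum>g\<leftarrow>remove1 f fs. 1 / to_fract g) \<in> ?I"
      using less.hyps by blast
    moreover have "1 / to_fract f \<in> ?I"
      using f less.prems(1) genideal_self[OF sub] by (auto simp: reciprocals_def)
    ultimately show ?thesis
      using I.a_closed unfolding split by fastforce
  qed
qed

theorem proposition2p8:
  fixes P :: "'a::idom fract set"
  assumes "primeideal P (reciprocal_complement :: 'a fract ring)"
  shows "\<exists>S \<subseteq> reciprocals. P = Idl\<^bsub>reciprocal_complement\<^esub> S"
proof (intro exI conjI)
  interpret primeideal P "reciprocal_complement :: 'a fract ring" by fact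
  show "P \<inter> reciprocals \<subseteq> reciprocals" by simp
  show "P = Idl\<^bsub>reciprocal_complement\<^esub> (P \<inter> reciprocals)"
  proof
    show "Idl\<^bsub>reciprocal_complement\<^esub> (P \<inter> reciprocals) \<subseteq> P"
      using genideal_minimal[OF is_ideal] by simp
    show "P \<subseteq> Idl\<^bsub>reciprocal_complement\<^esub> (P \<inter> reciprocals)"
    proof
      fix x
      assume "x \<in> P"
      moreover from this obtain fs where "x = (\<Sum>f\<leftarrow>fs. 1 / to_fract f)" "0 \<notin> set fs"
        using a_Hcarr carrier_reciprocal_complement by blast
      ultimately show "x \<in> Idl\<^bsub>reciprocal_complement\<^esub> (P \<inter> reciprocals)"
        using sum_reciprocals_in_genideal[OF assms] by blast
    qed
  qed
qed

end
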